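(* Suppose the graph is strongly connected with at least one directed spanning tree and that $\mathbf A-c\lambda_p\mathbf B\mathbf K$ is Hurwitz for all $p=2,\dots,N$. For $p=2,\dots,N$ let $$\tilde\Omega_p=\{\omega_p\in\mathbb R:\ \langle\mathbf G_p(j\omega_p)\mathbf z_p,\mathbf z_p\rangle<0\ \text{for some }\mathbf z_p\in\mathbb C^n\},$$ and let $\mathbb P$ be the set of all $p\in\{2,\dots,N\}$ with $\tilde\Omega_p\ne\emptyset$. Then the loop transfer function $\mathbf G_p(s)$, with positive definite Hermitian perturbation $\boldsymbol\Delta_p\in\mathbb C^{n\times n}$ in its feedback path, is stable if any one of the following is satisfied: (i) $\tilde\Omega_p=\emptyset$ for all $p=2,\dots,N$; (ii) for all $p\in\mathbb P$, the eigenvalues $\{\lambda_k(\boldsymbol\Delta_p)\}_{k=1}^n$ of the positive definite Hermitian perturbation $\boldsymbol\Delta_p$ in the feedback path of $\mathbf G_p(s)$ satisfy $\max_k|\ln(\lambda_k(\boldsymbol\Delta_p))|<g_p$, where $$g_p\le\inf_{\omega_p\in\tilde\Omega_p}\ \inf\left\{\cosh^{-1}\left[\frac{\mathbf v_p^*\mathbf v_p+\mathbf z_p^*\mathbf z_p}{2\,\mathbf v_p^*\mathbf z_p}\right]:\ \mathbf v_p,\mathbf z_p\in\mathbb C^n,\ \mathbf v_p=-\mathbf G_p(j\omega_p)\mathbf z_p,\ \mathbf v_p^*\mathbf z_p\ \text{real and positive}\right\}.$$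
   Context: $\mathbf L\in\mathbb R^{N\times N}$ is the Laplacian ($l_{ii}=\sum_{k\ne i}a_{ik}$, $l_{ik}=-a_{ik}$, with nonnegative edge weights $a_{ik}$) of a weighted directed graph on $N$ nodes; under the graph assumption its eigenvalues are $\lambda_1=0$ (simple) and $\lambda_2,\dots,\lambda_N$ with positive real part. $\mathbf A\in\mathbb R^{n\times n}$, $\mathbf B\in\mathbb R^{n\times m}$, $(\mathbf A,\mathbf B)$ is stabilizable, $\mathbf K\in\mathbb R^{m\times n}$ is such that $\mathbf A-\mathbf B\mathbf K$ is Hurwitz, and $c$ is a scalar coupling gain. The transformed loop transfer functions are $\mathbf G_p(s)=(s\mathbf I_n-\mathbf A)^{-1}\mathbf B\,c\lambda_p\mathbf K$, $p=2,\dots,N$. $\langle\mathbf x,\mathbf y\rangle=\mathbf x^*\mathbf y$ is the Hermitian inner product, and "$<0$" means real and negative. $\cosh^{-1}$ is the nonnegative inverse of $\cosh$ on $[1,\infty)$. "$\mathbf G_p(s)$ is stable with perturbation $\boldsymbol\Delta_p$ in the feedback path" means that the closed loop with loop transfer function $\mathbf G_p(s)\boldsymbol\Delta_p$ ($\boldsymbol\Delta_p$ constant) is stable, i.e. $\mathbf A-c\lambda_p\mathbf B\mathbf K\boldsymbol\Delta_p$ is Hurwitz.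
   Formalization: Where jω is an eigenvalue of A, so that G_p(jω) is undefined, "G_p(jω)z = w" is read as (jωI − A)w = cλ_pBKz, both in Ω̃_p and in the infimum bounding g_p; if such ω were left out, the claim would be false. *)

theory Defs
  imports "HOL-Analysis.Analysis" "HOL-Computational_Algebra.Polynomial"
begin

section \<open>Complex matrices\<close>

abbreviation cmat :: "real^'a^'b \<Rightarrow> complex^'a^'b" where
  "cmat \<equiv> map_matrix complex_of_real"

text \<open>\<open>hinner x y = x\<^sup>* y\<close>, conjugate-linear in the first argument.\<close>

definition hinner :: "complex^'n \<Rightarrow> complex^'n \<Rightarrow> complex" where
  "hinner x y = (\<Sum>i\<in>UNIV. cnj (x $ i) * y $ i)"

definition eigenvalue :: "complex^'n^'n \<Rightarrow> complex \<Rightarrow> bool" where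
  "eigenvalue M \<mu> \<longleftrightarrow> (\<exists>x. x \<noteq> 0 \<and> M *v x = \<mu> *s x)"

definition charpoly :: "complex^'n^'n \<Rightarrow> complex poly" where
  "charpoly M = det (mat [:0, 1:] - map_matrix (\<lambda>x. [:x:]) M)"

definition hurwitz :: "complex^'n^'n \<Rightarrow> bool" where
  "hurwitz M \<longleftrightarrow> (\<forall>\<mu>. eigenvalue M \<mu> \<longrightarrow> Re \<mu> < 0)"

definition stabilizable :: "real^'n^'n \<Rightarrow> real^'m^'n \<Rightarrow> bool" where
  "stabilizable A B \<longleftrightarrow> (\<exists>F :: real^'n^'m. hurwitz (cmat (A - B ** F)))"

definition hermitian :: "complex^'n^'n \<Rightarrow> bool" where
  "hermitian M \<longleftrightarrow> map_matrix cnj (transpose M) = M"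

definition pos_def_hermitian :: "complex^'n^'n \<Rightarrow> bool" where
  "pos_def_hermitian M \<longleftrightarrow> hermitian M \<and>
     (\<forall>x. x \<noteq> 0 \<longrightarrow> hinner x (M *v x) \<in> \<real> \<and> Re (hinner x (M *v x)) > 0)"

section \<open>Weighted directed graphs\<close>

text \<open>The weight \<open>a $ i $ k\<close> belongs to the edge from node \<open>k\<close> to node \<open>i\<close>.\<close>

definition edges :: "real^'v^'v \<Rightarrow> ('v \<times> 'v) set" where
  "edges a = {(k, i). a $ i $ k > 0}"

definition laplacian :: "real^'v^'v \<Rightarrow> real^'v^'v" where
  "laplacian a = (\<chi> i k. if i = k then (\<Sum>l\<in>UNIV - {i}. a $ i $ l) else - (a $ i $ k))"

definition strongly_connected :: "real^'v^'v \<Rightarrow> bool" where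
  "strongly_connected a \<longleftrightarrow> (\<forall>u v. (u, v) \<in> (edges a)\<^sup>*)"

definition directed_spanning_tree :: "real^'v^'v \<Rightarrow> 'v \<Rightarrow> ('v \<times> 'v) set \<Rightarrow> bool" where
  "directed_spanning_tree a r T \<longleftrightarrow> T \<subseteq> edges a \<and> (\<nexists>u. (u, r) \<in> T) \<and>
     (\<forall>v. v \<noteq> r \<longrightarrow> (\<exists>!u. (u, v) \<in> T)) \<and> (\<forall>v. (r, v) \<in> T\<^sup>*)"

section \<open>Loop transfer functions\<close>

text \<open>
  \<open>G(s) = (s I - A)\<^sup>-\<^sup>1 B \<mu> K\<close>, where \<open>\<mu>\<close> stands for \<open>c \<lambda>\<^sub>p\<close>.
\<close>

definition loop_tf ::
    "real^'n^'n \<Rightarrow> real^'m^'n \<Rightarrow> real^'n^'m \<Rightarrow> complex \<Rightarrow> complex \<Rightarrow> complex^'n^'n" where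
  "loop_tf A B K \<mu> s = matrix_inv (mat s - cmat A) ** cmat B ** (mat \<mu> ** cmat K)"

text \<open>
  The values of \<open>G(s) z\<close>. If \<open>s\<close> is not an eigenvalue of \<open>A\<close> this is the single vector
  \<open>G(s) z\<close>. If \<open>s\<close> is an eigenvalue of \<open>A\<close>, the inverse in \<open>G(s)\<close> does not exist, and the
  values are all solutions \<open>w\<close> of the defining equation \<open>(s I - A) w = B \<mu> K z\<close> (possibly
  none). Leaving such frequencies out instead would make the stability criterion false:
  for \<open>A = diag(1/2, 0)\<close>, \<open>B = K = I\<close>, \<open>\<mu> = 1\<close>, no \<open>\<omega> \<noteq> 0\<close> makes \<open>\<langle>G(j\<omega>)z, z\<rangle>\<close> negative,
  yet the perturbation \<open>diag(1/4, 1)\<close> destabilizes the loop.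
\<close>

definition loop_values ::
    "real^'n^'n \<Rightarrow> real^'m^'n \<Rightarrow> real^'n^'m \<Rightarrow> complex \<Rightarrow> complex \<Rightarrow> complex^'n \<Rightarrow> (complex^'n) set"
where
  "loop_values A B K \<mu> s z =
     (if invertible (mat s - cmat A) then {loop_tf A B K \<mu> s *v z}
      else {w. (mat s - cmat A) *v w = (cmat B ** (mat \<mu> ** cmat K)) *v z})"

definition crit_freqs ::
    "real^'n^'n \<Rightarrow> real^'m^'n \<Rightarrow> real^'n^'m \<Rightarrow> complex \<Rightarrow> real set" where
  "crit_freqs A B K \<mu> =
     {\<omega>. \<exists>z. \<exists>w \<in> loop_values A B K \<mu> (\<i> * of_real \<omega>) z. hinner w z \<in> \<real> \<and> Re (hinner w z) < 0}"

definition gain_set ::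
    "real^'n^'n \<Rightarrow> real^'m^'n \<Rightarrow> real^'n^'m \<Rightarrow> complex \<Rightarrow> real \<Rightarrow> real set" where
  "gain_set A B K \<mu> \<omega> =
     {arcosh (Re ((hinner v v + hinner z z) / (2 * hinner v z))) | v z.
        (\<exists>w \<in> loop_values A B K \<mu> (\<i> * of_real \<omega>) z. v = - w) \<and>
        hinner v z \<in> \<real> \<and> Re (hinner v z) > 0}"

text \<open>
  For \<open>\<omega> \<in> crit_freqs\<close> the set \<open>gain_set\<close> is nonempty, and its elements are nonnegative since
  \<open>v\<^sup>* v + z\<^sup>* z \<ge> 2 v\<^sup>* z\<close>; so the real infima below are the true ones whenever
  \<open>crit_freqs\<close> is nonempty, the only case in which they are used.
\<close>

definition gain_bound ::
    "real^'n^'n \<Rightarrow> real^'m^'n \<Rightarrow> real^'n^'m \<Rightarrow> complex \<Rightarrow> real" where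
  "gain_bound A B K \<mu> = (INF \<omega>\<in>crit_freqs A B K \<mu>. Inf (gain_set A B K \<mu> \<omega>))"

definition loop_stable ::
    "real^'n^'n \<Rightarrow> real^'m^'n \<Rightarrow> real^'n^'m \<Rightarrow> complex \<Rightarrow> complex^'n^'n \<Rightarrow> bool" where
  "loop_stable A B K \<mu> \<Delta> \<longleftrightarrow> hurwitz (cmat A - cmat B ** (mat \<mu> ** cmat K) ** \<Delta>)"

end

theory Submission
  imports Defs "HOL-Complex_Analysis.Great_Picard"
begin

text \<open>
  Only one loop at a time matters. Put \<open>H = B \<mu> K\<close>, so that \<open>A - H\<close> is Hurwitz, and suppose
  that a positive definite \<open>D\<close> makes \<open>A - H D\<close> fail to be Hurwitz. Along the segment
  \<open>D\<^sub>t = (1 - t) I + t D\<close> the eigenvalues of \<open>A - H D\<^sub>t\<close> move continuously out of the open left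
  half-plane, so for some \<open>t \<in> (0, 1]\<close> there is an eigenvalue \<open>\<i> \<omega>\<close> on the imaginary axis
  (\<open>hurwitz_path_crossing\<close>). If \<open>x\<close> is an eigenvector for it and \<open>z = D\<^sub>t x\<close>, then
  \<open>(\<i> \<omega> I - A) (- x) = H z\<close>, that is, \<open>- x\<close> is a value of \<open>G(\<i> \<omega>) z\<close>, and \<open>x\<^sup>* z > 0\<close> because
  \<open>D\<^sub>t\<close> is positive definite. Hence \<open>\<omega>\<close> is a critical frequency, and the pair \<open>(x, z)\<close>
  competes in the infimum that defines the gain bound.

  It remains to see how large the gain at this pair can be. Let \<open>m\<close> be the largest absolute value
  of the logarithm of an eigenvalue of \<open>D\<close>. All eigenvalues of \<open>D\<close>, and by convexity those of
  \<open>D\<^sub>t\<close>, lie in \<open>[exp (- m), exp m]\<close>, so \<open>(D\<^sub>t - exp (- m)) (D\<^sub>t - exp m)\<close> is negative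
  semidefinite (\<open>self_adjoint_quadratic_bound\<close>). Evaluated at \<open>x\<close> this says
  \<open>x\<^sup>* x + z\<^sup>* z \<le> 2 cosh m (x\<^sup>* z)\<close>, so the gain at \<open>(x, z)\<close> is at most \<open>m\<close>. Thus a
  destabilizing perturbation forces a critical frequency and a gain bound of at most \<open>m\<close>
  (\<open>destabilizing_perturbation\<close>), which contradicts either alternative of the hypothesis.
\<close>

section \<open>Self-adjoint operators\<close>

text \<open>
  A maximiser of the Rayleigh quotient is an eigenvector: the first variation of
  \<open>y \<bullet> f y - \<nu> (y \<bullet> y)\<close> at the maximiser \<open>x\<close> in the direction \<open>h = f x - \<nu> x\<close> is \<open>2 (h \<bullet> h)\<close>, and it
  must vanish.
\<close>

lemma self_adjoint_max_eigenvector: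
  fixes f :: "'a::euclidean_space \<Rightarrow> 'a"
  assumes lin: "linear f" and sa: "\<And>x y. f x \<bullet> y = x \<bullet> f y"
  obtains x \<nu> where "norm x = 1" "f x = \<nu> *\<^sub>R x" "\<And>y. y \<bullet> f y \<le> \<nu> * (norm y)\<^sup>2"
proof -
  have "(sphere 0 1 :: 'a set) \<noteq> {}"
    by simp
  moreover have "continuous_on (sphere 0 1) (\<lambda>y. y \<bullet> f y)"
    by (intro continuous_intros linear_continuous_on linear_conv_bounded_linear[THEN iffD1, OF lin])
  ultimately obtain x where x: "norm x = 1" and max: "\<And>y. norm y = 1 \<Longrightarrow> y \<bullet> f y \<le> x \<bullet> f x"
    using continuous_attains_sup[of "sphere 0 1" "\<lambda>y. y \<bullet> f y"] by auto
  define \<nu> where "\<nu> = x \<bullet> f x"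
  have bound: "y \<bullet> f y \<le> \<nu> * (norm y)\<^sup>2" for y
  proof (cases "y = 0")
    case True
    then show ?thesis by (simp add: linear_0[OF lin])
  next
    case False
    then have "(y /\<^sub>R norm y) \<bullet> f (y /\<^sub>R norm y) \<le> \<nu>"
      unfolding \<nu>_def by (intro max) simp
    then show ?thesis
      using False by (simp add: linear_cmul[OF lin] field_simps power2_eq_square)
  qed
  define h where "h = f x - \<nu> *\<^sub>R x"
  define c where "c = h \<bullet> f h - \<nu> * (h \<bullet> h)"
  have var: "2 * s * (h \<bullet> h) + s\<^sup>2 * c \<le> 0" for s
  proof -
    have "(x + s *\<^sub>R h) \<bullet> f (x + s *\<^sub>R h) \<le> \<nu> * ((x + s *\<^sub>R h) \<bullet> (x + s *\<^sub>R h))"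
      using bound[of "x + s *\<^sub>R h"] by (simp add: power2_norm_eq_inner)
    moreover have "(x + s *\<^sub>R h) \<bullet> f (x + s *\<^sub>R h) =
        \<nu> + 2 * s * (f x \<bullet> h) + s\<^sup>2 * (h \<bullet> f h)"
      using sa[of x h]
      by (simp add: linear_add[OF lin] linear_cmul[OF lin] inner_add \<nu>_def inner_commute
          power2_eq_square algebra_simps)
    moreover have "\<nu> * ((x + s *\<^sub>R h) \<bullet> (x + s *\<^sub>R h)) =
        \<nu> + 2 * s * (\<nu> * (x \<bullet> h)) + s\<^sup>2 * (\<nu> * (h \<bullet> h))"
      using x by (simp add: norm_eq_1 inner_add inner_commute power2_eq_square algebra_simps)
    ultimately have "2 * s * (f x \<bullet> h) + s\<^sup>2 * (h \<bullet> f h) \<le>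
        2 * s * (\<nu> * (x \<bullet> h)) + s\<^sup>2 * (\<nu> * (h \<bullet> h))"
      by linarith
    moreover have "h \<bullet> h = f x \<bullet> h - \<nu> * (x \<bullet> h)"
      by (metis h_def inner_diff_left inner_scaleR_left)
    then have "2 * s * (h \<bullet> h) = 2 * s * (f x \<bullet> h) - 2 * s * (\<nu> * (x \<bullet> h))"
      by (simp only: right_diff_distrib)
    ultimately show ?thesis
      by (simp add: c_def right_diff_distrib)
  qed
  have "h = 0"
  proof (rule ccontr)
    assume "h \<noteq> 0"
    then have hh: "h \<bullet> h > 0" by simp
    define s where "s = (h \<bullet> h) / (\<bar>c\<bar> + 1)"
    have s: "s > 0" "s * \<bar>c\<bar> < h \<bullet> h"
      using hh by (auto simp: s_def field_simps)
    have "s * (2 * (h \<bullet> h) + s * c) \<le> 0"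
      using var[of s] by (simp add: power2_eq_square algebra_simps)
    then have "2 * (h \<bullet> h) + s * c \<le> 0"
      using s by (simp add: mult_le_0_iff)
    moreover have "s * c \<ge> - (s * \<bar>c\<bar>)"
      using s(1) by (smt (verit) mult_left_mono mult_minus_right abs_ge_minus_self)
    ultimately show False using s hh by linarith
  qed
  then show ?thesis
    using that x bound by (auto simp: h_def)
qed

text \<open>
  The operator \<open>q = (f - \<alpha>) (f - \<beta>)\<close> is negative semidefinite. In place of a diagonalisation of \<open>f\<close>:
  if the largest eigenvalue \<open>\<nu>\<close> of \<open>q\<close> were positive, the polynomial \<open>(s - \<alpha>) (s - \<beta>) - \<nu>\<close> would
  have its real roots outside \<open>[\<alpha>, \<beta>]\<close>, while an eigenvector of \<open>q\<close> for \<open>\<nu>\<close> is annihilated by that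
  polynomial in \<open>f\<close>, which makes one of the roots an eigenvalue of \<open>f\<close>.
\<close>

lemma self_adjoint_quadratic_bound:
  fixes f :: "'a::euclidean_space \<Rightarrow> 'a"
  assumes lin: "linear f" and sa: "\<And>x y. f x \<bullet> y = x \<bullet> f y"
    and spec: "\<And>x \<nu>. x \<noteq> 0 \<Longrightarrow> f x = \<nu> *\<^sub>R x \<Longrightarrow> \<alpha> \<le> \<nu> \<and> \<nu> \<le> \<beta>"
  shows "(norm (f x))\<^sup>2 + \<alpha> * \<beta> * (norm x)\<^sup>2 \<le> (\<alpha> + \<beta>) * (x \<bullet> f x)"
proof -
  define q where "q y = f (f y) - (\<alpha> + \<beta>) *\<^sub>R f y + (\<alpha> * \<beta>) *\<^sub>R y" for y
  have "linear q"
    by (rule linearI)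
      (simp_all add: q_def linear_add[OF lin] linear_cmul[OF lin] algebra_simps)
  moreover have "q x \<bullet> y = x \<bullet> q y" for x y
    by (simp add: q_def inner_add inner_diff sa)
  ultimately obtain y \<nu> where y: "norm y = 1" "q y = \<nu> *\<^sub>R y"
    and max: "\<And>x. x \<bullet> q x \<le> \<nu> * (norm x)\<^sup>2"
    using self_adjoint_max_eigenvector by blast
  have "\<alpha> \<le> \<beta>"
    using self_adjoint_max_eigenvector[OF lin sa] spec by (metis norm_zero order_trans zero_neq_one)
  have "\<nu> \<le> 0"
  proof (rule ccontr)
    assume "\<not> \<nu> \<le> 0"
    \<comment> \<open>\<open>\<sigma>\<close> and \<open>\<tau>\<close> are the two roots of \<open>(s - \<alpha>) (s - \<beta>) = \<nu>\<close>.\<close>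
    define d where "d = sqrt ((\<beta> - \<alpha>)\<^sup>2 + 4 * \<nu>)"
    define \<sigma> \<tau> where "\<sigma> = (\<alpha> + \<beta> - d) / 2" and "\<tau> = (\<alpha> + \<beta> + d) / 2"
    have "d > \<beta> - \<alpha>"
      unfolding d_def using \<open>\<not> \<nu> \<le> 0\<close> by (intro real_less_rsqrt) simp
    then have out: "\<sigma> < \<alpha>" "\<tau> > \<beta>"
      by (auto simp: \<sigma>_def \<tau>_def)
    have "d\<^sup>2 = (\<beta> - \<alpha>)\<^sup>2 + 4 * \<nu>"
      using \<open>\<not> \<nu> \<le> 0\<close> by (simp add: d_def)
    then have prod: "\<sigma> * \<tau> = \<alpha> * \<beta> - \<nu>"
      by (simp add: \<sigma>_def \<tau>_def field_simps power2_eq_square)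
    define u where "u = f y - \<tau> *\<^sub>R y"
    have "f u - \<sigma> *\<^sub>R u = f (f y) - (\<sigma> + \<tau>) *\<^sub>R f y + (\<sigma> * \<tau>) *\<^sub>R y"
      by (simp add: u_def linear_diff[OF lin] linear_cmul[OF lin] algebra_simps)
    also have "\<sigma> + \<tau> = \<alpha> + \<beta>"
      by (simp add: \<sigma>_def \<tau>_def field_simps)
    also have "f (f y) - (\<alpha> + \<beta>) *\<^sub>R f y + (\<sigma> * \<tau>) *\<^sub>R y = q y - \<nu> *\<^sub>R y"
      unfolding prod by (simp add: q_def algebra_simps)
    finally have "f u = \<sigma> *\<^sub>R u"
      using y by simp
    then have "u = 0"
      using spec[of u \<sigma>] out by fastforce
    then have "f y = \<tau> *\<^sub>R y" by (simp add: u_def)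
    then show False
      using spec[of y \<tau>] y out by fastforce
  qed
  then have "x \<bullet> q x \<le> 0"
    using max[of x] by (meson mult_nonpos_nonneg order_trans zero_le_power2)
  then show ?thesis
    by (simp add: q_def inner_add inner_diff power2_norm_eq_inner sa[symmetric])
qed

text \<open>
  Eigenvectors for distinct eigenvalues are orthogonal, hence linearly independent.
\<close>

lemma finite_self_adjoint_eigenvalues:
  fixes f :: "'a::euclidean_space \<Rightarrow> 'a"
  assumes sa: "\<And>x y. f x \<bullet> y = x \<bullet> f y"
  shows "finite {\<nu>. \<exists>x. x \<noteq> 0 \<and> f x = \<nu> *\<^sub>R x}" 
proof -
  define E where "E = {\<nu>. \<exists>x. x \<noteq> 0 \<and> f x = \<nu> *\<^sub>R x}"
  define e where "e \<nu> = (SOME x. x \<noteq> 0 \<and> f x = \<nu> *\<^sub>R x)" for \<nu>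
  have e: "e \<nu> \<noteq> 0" "f (e \<nu>) = \<nu> *\<^sub>R e \<nu>" if "\<nu> \<in> E" for \<nu>
    using someI_ex[of "\<lambda>x. x \<noteq> 0 \<and> f x = \<nu> *\<^sub>R x"] that by (auto simp: e_def E_def)
  have orth: "e \<mu> \<bullet> e \<nu> = 0" if "\<mu> \<in> E" "\<nu> \<in> E" "\<mu> \<noteq> \<nu>" for \<mu> \<nu>
    using sa[of "e \<mu>" "e \<nu>"] e(2)[OF that(1)] e(2)[OF that(2)] that(3) by simp
  have "inj_on e E"
  proof (rule inj_onI, rule ccontr)
    fix \<mu> \<nu> assume "\<mu> \<in> E" "\<nu> \<in> E" "e \<mu> = e \<nu>" "\<mu> \<noteq> \<nu>"
    then show False
      using orth[of \<mu> \<nu>] e(1)[of \<nu>] by simp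
  qed
  moreover have "pairwise orthogonal (e ` E)"
    unfolding pairwise_def orthogonal_def using orth by blast
  moreover have "0 \<notin> e ` E"
    using e(1) by force
  ultimately have "finite E"
    using finite_imageD independent_imp_finite pairwise_orthogonal_independent by blast
  then show ?thesis
    by (simp add: E_def)
qed

section \<open>Crossing the imaginary axis\<close>

lemma mat_vector_mult: "mat k *v x = k *s (x :: 'a::comm_semiring_1^'n)"
  by (simp add: vec_eq_iff matrix_vector_mult_def mat_def if_distrib[where f="\<lambda>u. u * _"] cong: if_cong)

lemma eigenvalue_iff_det:
  "eigenvalue M \<mu> \<longleftrightarrow> det (mat \<mu> - M) = 0"
proof -
  have "det (mat \<mu> - M) = 0 \<longleftrightarrow> \<not> invertible (mat \<mu> - M)"
    by (simp add: invertible_det_nz)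
  also have "\<dots> \<longleftrightarrow> (\<exists>x. (mat \<mu> - M) *v x = 0 \<and> x \<noteq> 0)"
    by (auto simp: invertible_left_inverse matrix_left_invertible_ker)
  also have "\<dots> \<longleftrightarrow> eigenvalue M \<mu>"
    unfolding eigenvalue_def matrix_vector_mult_diff_rdistrib mat_vector_mult
    by (metis eq_iff_diff_eq_0)
  finally show ?thesis ..
qed

text \<open>
  Apply the triangle inequality to each entry of \<open>M x = \<mu> x\<close> and add the entries. Only some bound that is
  uniform for \<open>M\<close> in bounded sets is wanted; this one is far from sharp.
\<close>

lemma eigenvalue_norm_le:
  fixes M :: "complex^'n^'n"
  assumes "eigenvalue M \<mu>"
  shows "norm \<mu> \<le> CARD('n) * norm M"
proof -
  obtain x where x: "x \<noteq> 0" "M *v x = \<mu> *s x"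
    using assms by (auto simp: eigenvalue_def)
  define S where "S = (\<Sum>i\<in>UNIV. norm (x $ i))"
  obtain i where "x $ i \<noteq> 0"
    using x(1) by (auto simp: vec_eq_iff)
  then have "S > 0"
    unfolding S_def by (intro sum_pos2[of _ i]) auto
  have "norm \<mu> * norm (x $ i) \<le> norm M * S" for i
  proof -
    have "\<mu> * x $ i = (\<Sum>j\<in>UNIV. M $ i $ j * x $ j)"
      using x(2) by (simp add: vec_eq_iff matrix_vector_mult_def)
    then have "norm \<mu> * norm (x $ i) = norm (\<Sum>j\<in>UNIV. M $ i $ j * x $ j)"
      by (metis norm_mult)
    also have "\<dots> \<le> (\<Sum>j\<in>UNIV. norm (M $ i $ j) * norm (x $ j))"
      by (rule order_trans[OF norm_sum]) (simp add: norm_mult)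
    also have "\<dots> \<le> (\<Sum>j\<in>UNIV. norm M * norm (x $ j))"
      by (intro sum_mono mult_right_mono)
        (auto intro: order_trans[OF Finite_Cartesian_Product.norm_nth_le]
          Finite_Cartesian_Product.norm_nth_le)
    finally show ?thesis by (simp add: S_def sum_distrib_left)
  qed
  then have "(\<Sum>i\<in>(UNIV::'n set). norm \<mu> * norm (x $ i)) \<le> (\<Sum>i\<in>(UNIV::'n set). norm M * S)"
    by (intro sum_mono)
  then have "norm \<mu> * S \<le> (CARD('n) * norm M) * S"
    by (simp add: S_def flip: sum_distrib_left)
  then show ?thesis
    using \<open>S > 0\<close> by simp
qed

lemma continuous_on_det_pencil:
  fixes M :: "'t::topological_space \<Rightarrow> complex^'n^'n"
  assumes "continuous_on S f" "continuous_on S M"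
  shows "continuous_on S (\<lambda>s. det (mat (f s) - M s))"
proof -
  have "continuous_on S (\<lambda>s. (mat (f s) - M s) $ i $ j)" for i j
    by (cases "i = j") (auto simp: mat_def intro!: continuous_intros assms)
  then show ?thesis
    unfolding det_def
    by (intro continuous_on_sum continuous_on_mult continuous_on_prod continuous_on_const)
qed

lemma holomorphic_on_det_pencil: "(\<lambda>z. det (mat z - M)) holomorphic_on S"
proof -
  have "(\<lambda>z. (mat z - M) $ i $ j) holomorphic_on S" for i j
    by (cases "i = j") (auto simp: mat_def intro!: holomorphic_intros)
  then show ?thesis
    unfolding det_def by (intro holomorphic_intros)
qed

text \<open>
  By Hurwitz's theorem on zeros, a locally uniform limit of zero-free holomorphic functions on a connected domain is
  zero-free or constant; it is applied to the characteristic functions \<open>det (z I - M (s n))\<close> for a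
  sequence of times \<open>s n\<close> that increases to \<open>t\<close>.
\<close>

lemma eigenvalue_limit_of_hurwitz:
  fixes M :: "real \<Rightarrow> complex^'n^'n"
  assumes cont: "continuous_on {0..1} M" and t: "0 < t" "t \<le> 1"
    and stable: "\<And>s. 0 \<le> s \<Longrightarrow> s < t \<Longrightarrow> hurwitz (M s)"
    and ev: "eigenvalue (M t) \<mu>"
  shows "Re \<mu> \<le> 0"
proof (rule ccontr)
  assume "\<not> Re \<mu> \<le> 0"
  define S where "S = {z. Re z > 0}"
  define s where "s n = t - t * inverse (real (Suc n))" for n
  have s: "0 \<le> s n" "s n < t" for n
    using t by (auto simp: s_def field_simps)
  have "s \<longlonglongrightarrow> t - t * 0"
    unfolding s_def by (intro tendsto_intros LIMSEQ_inverse_real_of_nat)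
  then have lim: "s \<longlonglongrightarrow> t" by simp
  have "det (mat \<mu> - M t) \<noteq> 0"
  proof (rule Hurwitz_no_zeros[of S "\<lambda>n z. det (mat z - M (s n))" "\<lambda>z. det (mat z - M t)" \<mu>])
    show "open S" "connected S"
      by (auto simp: S_def open_halfspace_Re_gt convex_halfspace_Re_gt convex_connected)
    show "\<mu> \<in> S" using \<open>\<not> Re \<mu> \<le> 0\<close> by (simp add: S_def)
    show "det (mat z - M (s n)) \<noteq> 0" if "z \<in> S" for n z
      using stable[OF s, of n] that
      by (auto simp: hurwitz_def eigenvalue_iff_det S_def)
    \<comment> \<open>A constant function with the zero \<open>\<mu>\<close> would make every \<open>r > 0\<close> an eigenvalue, however large.\<close>
    show "\<not> (\<lambda>z. det (mat z - M t)) constant_on S"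
    proof
      assume "(\<lambda>z. det (mat z - M t)) constant_on S"
      moreover define r where "r = CARD('n) * norm (M t) + 1"
      have "r > 0" by (simp add: r_def add_nonneg_pos)
      then have "of_real r \<in> S" by (simp add: S_def)
      ultimately have "det (mat (of_real r) - M t) = det (mat \<mu> - M t)"
        using \<open>\<mu> \<in> S\<close> unfolding constant_on_def by metis
      then have "eigenvalue (M t) (of_real r)"
        using ev by (simp add: eigenvalue_iff_det)
      from eigenvalue_norm_le[OF this] have "\<bar>r\<bar> \<le> CARD('n) * norm (M t)"
        by (simp only: norm_of_real)
      then show False
        by (simp add: r_def)
    qed
    show "uniform_limit K (\<lambda>n z. det (mat z - M (s n))) (\<lambda>z. det (mat z - M t)) sequentially"
      if "compact K" for K
    proof (rule uniform_limitI)
      fix e :: real assume "e > 0"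
      have "continuous_on ({0..1} \<times> K) (\<lambda>p. det (mat (snd p) - M (fst p)))"
        by (intro continuous_on_det_pencil continuous_on_compose2[OF cont] continuous_intros) auto
      then obtain X where X: "t \<in> X" "open X"
        "\<forall>s\<in>X \<inter> {0..1}. \<forall>z\<in>K. dist (det (mat z - M s)) (det (mat z - M t)) \<le> e / 2"
        using continuous_on_prod_compactE[of "{0..1}" K _ t "e / 2"] \<open>compact K\<close> t \<open>e > 0\<close>
        by (metis (no_types, lifting) atLeastAtMost_iff fst_conv half_gt_zero less_imp_le snd_conv)
      have "\<forall>\<^sub>F n in sequentially. s n \<in> X"
        by (rule topological_tendstoD[OF lim X(2,1)])
      then show "\<forall>\<^sub>F n in sequentially. \<forall>z\<in>K. dist (det (mat z - M (s n))) (det (mat z - M t)) < e"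
      proof eventually_elim
        case (elim n)
        then have "s n \<in> X \<inter> {0..1}"
          using s[of n] t by auto
        show ?case
        proof
          fix z assume "z \<in> K"
          then have "dist (det (mat z - M (s n))) (det (mat z - M t)) \<le> e / 2"
            using X(3) \<open>s n \<in> X \<inter> {0..1}\<close> by blast
          then show "dist (det (mat z - M (s n))) (det (mat z - M t)) < e"
            using \<open>e > 0\<close> by linarith
        qed
      qed
    qed
  next
    show "(\<lambda>z. det (mat z - M (s n))) holomorphic_on S" for n
      by (rule holomorphic_on_det_pencil)
    show "(\<lambda>z. det (mat z - M t)) holomorphic_on S"
      by (rule holomorphic_on_det_pencil)
  qed
  then show False using ev by (simp add: eigenvalue_iff_det)
qed

text \<open>
  The pairs \<open>(t, \<mu>)\<close> with \<open>\<mu>\<close> an eigenvalue of \<open>M t\<close> in the closed right half-plane form a compact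
  set, so there is a first time \<open>t\<close> at which such an eigenvalue exists. At that time it lies on the
  imaginary axis, because \<open>M t\<close> is a limit of Hurwitz matrices.
\<close>

lemma hurwitz_path_crossing:
  fixes M :: "real \<Rightarrow> complex^'n^'n"
  assumes cont: "continuous_on {0..1} M" and "hurwitz (M 0)" "\<not> hurwitz (M 1)"
  obtains t \<omega> where "0 < t" "t \<le> 1" "eigenvalue (M t) (\<i> * of_real \<omega>)"
proof -
  obtain C where C: "\<And>t. t \<in> {0..1} \<Longrightarrow> norm (M t) \<le> C"
    using compact_imp_bounded[OF compact_continuous_image[OF cont]] unfolding bounded_iff by blast
  define R where "R = CARD('n) * C"
  define U where "U = {p \<in> {0..1} \<times> (cball 0 R \<inter> {\<mu>. Re \<mu> \<ge> 0}). det (mat (snd p) - M (fst p)) = 0}"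
  have U: "(t, \<mu>) \<in> U \<longleftrightarrow> 0 \<le> t \<and> t \<le> 1 \<and> Re \<mu> \<ge> 0 \<and> eigenvalue (M t) \<mu>" for t \<mu>
  proof -
    have "norm \<mu> \<le> R" if "0 \<le> t" "t \<le> 1" "eigenvalue (M t) \<mu>"
      unfolding R_def using eigenvalue_norm_le[OF that(3)] C[of t] that
      by (smt (verit) atLeastAtMost_iff mult_left_mono of_nat_0_le_iff)
    then show ?thesis
      by (auto simp: U_def eigenvalue_iff_det)
  qed
  have "compact ({0..1::real} \<times> (cball (0::complex) R \<inter> {\<mu>. Re \<mu> \<ge> 0}))"
    by (intro compact_Times compact_Int_closed closed_halfspace_Re_ge) auto
  moreover have "closedin (top_of_set ({0..1} \<times> (cball 0 R \<inter> {\<mu>. Re \<mu> \<ge> 0}))) U"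
    unfolding U_def
    by (intro continuous_closedin_preimage_constant continuous_on_det_pencil
        continuous_on_compose2[OF cont] continuous_intros) auto
  ultimately have "compact U"
    by (rule closedin_compact)
  moreover have "U \<noteq> {}"
  proof -
    obtain \<mu> where "(1, \<mu>) \<in> U"
      using \<open>\<not> hurwitz (M 1)\<close> by (auto simp: hurwitz_def U not_less)
    then show ?thesis by blast
  qed
  ultimately obtain p where p: "p \<in> U" "\<And>q. q \<in> U \<Longrightarrow> fst p \<le> fst q"
    using continuous_attains_inf[of U fst] continuous_on_fst[OF continuous_on_id] by blast
  obtain t \<mu> where p_eq: "p = (t, \<mu>)" by fastforce
  then have t: "0 \<le> t" "t \<le> 1" "Re \<mu> \<ge> 0" "eigenvalue (M t) \<mu>"
    using p U by auto
  have "t \<noteq> 0"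
    using t \<open>hurwitz (M 0)\<close> by (auto simp: hurwitz_def)
  with t have "t > 0" by simp
  have "hurwitz (M s)" if "0 \<le> s" "s < t" for s
  proof -
    have "(s, z) \<notin> U" for z
      using p(2)[of "(s, z)"] that by (auto simp: p_eq)
    then show ?thesis
      using that t by (auto simp: U hurwitz_def not_le)
  qed
  then have "Re \<mu> \<le> 0"
    by (rule eigenvalue_limit_of_hurwitz[OF cont \<open>t > 0\<close> t(2) _ t(4)])
  then have "\<mu> = \<i> * of_real (Im \<mu>)"
    using t(3) by (simp add: complex_eq_iff)
  then show ?thesis
    using that \<open>t > 0\<close> t by metis
qed

section \<open>Positive definite perturbations\<close>

lemma Re_hinner: "Re (hinner x y) = x \<bullet> y"
  by (simp add: hinner_def inner_vec_def inner_complex_def)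

lemma hinner_self: "hinner x x = of_real ((norm x)\<^sup>2)"
proof (rule complex_eqI)
  show "Re (hinner x x) = Re (of_real ((norm x)\<^sup>2))"
    by (simp add: Re_hinner power2_norm_eq_inner)
  show "Im (hinner x x) = Im (of_real ((norm x)\<^sup>2))"
    by (simp add: hinner_def)
qed

lemma hinner_uminus_left: "hinner (- x) y = - hinner x y"
  by (simp add: hinner_def sum_negf)

lemma hinner_scaleR_add:
  "hinner x (r *\<^sub>R y + r' *\<^sub>R z) = of_real r * hinner x y + of_real r' * hinner x z"
  by (simp add: hinner_def scaleR_conv_of_real[where 'a=complex] sum_distrib_left sum.distrib
      algebra_simps)

lemma hermitian_hinner:
  assumes "hermitian M"
  shows "hinner (M *v x) y = hinner x (M *v y)"
proof -
  have M: "cnj (M $ i $ j) = M $ j $ i" for i j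
    using assms by (simp add: hermitian_def vec_eq_iff map_matrix_def transpose_def)
  have "hinner (M *v x) y = (\<Sum>i\<in>UNIV. \<Sum>j\<in>UNIV. M $ j $ i * cnj (x $ j) * y $ i)"
    by (simp add: hinner_def matrix_vector_mult_def M sum_distrib_right)
  also have "\<dots> = (\<Sum>j\<in>UNIV. \<Sum>i\<in>UNIV. M $ j $ i * cnj (x $ j) * y $ i)"
    by (rule sum.swap)
  also have "\<dots> = hinner x (M *v y)"
    by (simp add: hinner_def matrix_vector_mult_def sum_distrib_left mult_ac)
  finally show ?thesis .
qed

lemma hermitian_inner: "hermitian M \<Longrightarrow> (M *v x) \<bullet> y = x \<bullet> (M *v y)"
  using hermitian_hinner[of M x y] by (metis Re_hinner)

lemma of_real_smult_vec: "of_real r *s (x :: complex^'n) = r *\<^sub>R x"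
  by (simp add: vec_eq_iff scaleR_conv_of_real[where 'a=complex])

lemma scaleR_mult_vec: "(r *\<^sub>R M) *v x = r *\<^sub>R (M *v (x :: complex^'n))"
  by (simp add: vec_eq_iff matrix_vector_mult_def scaleR_sum_right)

text \<open>
  The last conclusion views \<open>D\<close> as an operator on the real inner product space underlying \<open>complex^'n\<close>,
  where the results on self-adjoint operators apply.
\<close>

lemma pos_def_hermitian_eigenvalue:
  assumes "pos_def_hermitian D" "eigenvalue D \<mu>"
  obtains r where "\<mu> = of_real r" "r > 0" "\<exists>x. x \<noteq> 0 \<and> D *v x = r *\<^sub>R x"
proof -
  obtain x where x: "x \<noteq> 0" "D *v x = \<mu> *s x"
    using assms by (auto simp: eigenvalue_def)
  have "hinner x (D *v x) = \<mu> * hinner x x"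
    by (simp add: x(2) hinner_def sum_distrib_left mult_ac)
  then have "\<mu> = hinner x (D *v x) / of_real ((norm x)\<^sup>2)"
    using x(1) by (simp add: hinner_self)
  moreover have h: "hinner x (D *v x) = of_real (Re (hinner x (D *v x)))"
    "Re (hinner x (D *v x)) > 0"
    using assms(1) x(1) by (auto simp: pos_def_hermitian_def complex_is_Real_iff complex_eq_iff)
  ultimately have \<mu>: "\<mu> = of_real (Re (hinner x (D *v x)) / (norm x)\<^sup>2)"
    by (metis of_real_divide)
  show ?thesis
    using that[OF \<mu>] x h(2) \<mu> by (metis divide_pos_pos of_real_smult_vec zero_less_norm_iff zero_less_power)
qed

text \<open>
  For positive definite \<open>D\<close> this is the Thompson distance of \<open>D\<close> from the identity.
\<close>

definition log_spread :: "complex^'n^'n \<Rightarrow> real" where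
  "log_spread D = Max {\<bar>ln (Re \<mu>)\<bar> | \<mu>. eigenvalue D \<mu>}"

text \<open>
  The finiteness of the spectrum is what makes the \<open>Max\<close> in \<open>log_spread\<close> an upper bound.
\<close>

lemma log_spread_bounds:
  assumes D: "pos_def_hermitian D" and x: "x \<noteq> 0" "D *v x = r *\<^sub>R x"
  shows "exp (- log_spread D) \<le> r" "r \<le> exp (log_spread D)"
proof -
  have sub: "{\<mu>. eigenvalue D \<mu>} \<subseteq> of_real ` {\<nu>. \<exists>x. x \<noteq> 0 \<and> D *v x = \<nu> *\<^sub>R x}"
    using pos_def_hermitian_eigenvalue[OF D] by (smt (verit) image_iff mem_Collect_eq subsetI)
  have "finite {\<mu>. eigenvalue D \<mu>}"
    using D by (intro finite_subset[OF sub] finite_imageI finite_self_adjoint_eigenvalues)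
      (simp add: pos_def_hermitian_def hermitian_inner)
  moreover have "{\<bar>ln (Re \<mu>)\<bar> | \<mu>. eigenvalue D \<mu>} = (\<lambda>\<mu>. \<bar>ln (Re \<mu>)\<bar>) ` {\<mu>. eigenvalue D \<mu>}"
    by auto
  moreover have ev: "eigenvalue D (of_real r)"
    using x by (auto simp: eigenvalue_def of_real_smult_vec)
  ultimately have "\<bar>ln r\<bar> \<le> log_spread D"
    unfolding log_spread_def
    by (metis (mono_tags, lifting) Max_ge Re_complex_of_real finite_imageI image_eqI mem_Collect_eq)
  moreover have "r > 0"
    using pos_def_hermitian_eigenvalue[OF D ev] by (metis of_real_eq_iff)
  ultimately show "exp (- log_spread D) \<le> r" "r \<le> exp (log_spread D)"
    using exp_le_cancel_iff[of "- log_spread D" "ln r"] exp_le_cancel_iff[of "ln r" "log_spread D"]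
    by simp_all
qed

lemma log_spread_nonneg:
  assumes D: "pos_def_hermitian D"
  shows "log_spread D \<ge> 0"
proof -
  have "\<And>x y. (D *v x) \<bullet> y = x \<bullet> (D *v y)"
    using D by (simp add: pos_def_hermitian_def hermitian_inner)
  then obtain x r where "norm x = 1" "D *v x = r *\<^sub>R x"
    using self_adjoint_max_eigenvector[OF matrix_vector_mul_linear] by metis
  then have "exp (- log_spread D) \<le> exp (log_spread D)"
    using log_spread_bounds[OF D] by (metis norm_zero order_trans zero_neq_one)
  then show ?thesis by simp
qed

text \<open>
  The quadratic bound for \<open>D\<^sub>t = (1 - t) I + t D\<close>, with \<open>\<alpha> = exp (- m)\<close> and \<open>\<beta> = exp m\<close>, so that
  \<open>\<alpha> \<beta> = 1\<close> and \<open>\<alpha> + \<beta> = 2 cosh m\<close>. An eigenvalue of \<open>D\<^sub>t\<close> is a convex combination of \<open>1\<close> and an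
  eigenvalue of \<open>D\<close>.
\<close>

lemma segment_perturbation_bound:
  fixes x :: "complex^'n"
  assumes D: "pos_def_hermitian D" and t: "0 < t" "t \<le> 1"
  defines "z \<equiv> (1 - t) *\<^sub>R x + t *\<^sub>R (D *v x)"
  shows "(norm x)\<^sup>2 + (norm z)\<^sup>2 \<le> 2 * cosh (log_spread D) * (x \<bullet> z)"
proof -
  define m where "m = log_spread D"
  define f where "f = (\<lambda>x. (1 - t) *\<^sub>R x + t *\<^sub>R (D *v x))"
  have "(norm (f x))\<^sup>2 + exp (- m) * exp m * (norm x)\<^sup>2 \<le> (exp (- m) + exp m) * (x \<bullet> f x)"
  proof (rule self_adjoint_quadratic_bound)
    show "linear f"
      unfolding f_def
      by (intro linear_compose_add linear_compose_scale_right linear_ident matrix_vector_mul_linear)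
    show "f x \<bullet> y = x \<bullet> f y" for x y
      using D by (simp add: f_def inner_add pos_def_hermitian_def hermitian_inner)
    show "exp (- m) \<le> \<sigma> \<and> \<sigma> \<le> exp m" if y: "y \<noteq> 0" "f y = \<sigma> *\<^sub>R y" for y \<sigma>
    proof -
      define r where "r = (\<sigma> - (1 - t)) / t"
      have "t *\<^sub>R (D *v y) = (\<sigma> - (1 - t)) *\<^sub>R y"
        using y(2) by (simp add: f_def algebra_simps)
      then have "D *v y = r *\<^sub>R y"
        using t by (simp add: r_def vector_fraction_eq_iff eq_vector_fraction_iff)
      then have r: "exp (- m) \<le> r" "r \<le> exp m"
        using log_spread_bounds[OF D y(1)] by (auto simp: m_def)
      have 1: "exp (- m) \<le> 1" "1 \<le> exp m"
        using log_spread_nonneg[OF D] by (auto simp: m_def)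
      have "\<sigma> = (1 - t) * 1 + t * r"
        using t by (simp add: r_def)
      moreover have "exp (- m) \<le> (1 - t) * 1 + t * r" "(1 - t) * 1 + t * r \<le> exp m"
        using convex_bound_le[of 1 "exp m" r "1 - t" t, OF 1(2) r(2)]
          convex_bound_le[of "-1" "- exp (- m)" "-r" "1 - t" t] r(1) 1(1) t by linarith+
      ultimately show ?thesis by (simp only:)
    qed
  qed
  moreover have "exp (- m) * exp m = 1" "exp (- m) + exp m = 2 * cosh m"
    by (simp_all add: cosh_def flip: exp_add)
  moreover have "f x = z"
    by (simp only: f_def z_def)
  ultimately show ?thesis
    by (simp only: m_def mult_1 add.commute)
qed

lemma segment_perturbation_pos:
  fixes x :: "complex^'n"
  assumes "pos_def_hermitian D" "0 < t" "t \<le> 1" "x \<noteq> 0"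
  defines "z \<equiv> (1 - t) *\<^sub>R x + t *\<^sub>R (D *v x)"
  shows "hinner x z \<in> \<real>" "Re (hinner x z) > 0"
proof -
  have z: "hinner x z = of_real (1 - t) * hinner x x + of_real t * hinner x (D *v x)"
    unfolding z_def by (rule hinner_scaleR_add)
  then show "hinner x z \<in> \<real>"
    using assms by (simp add: hinner_self pos_def_hermitian_def)
  have "Re (hinner x (D *v x)) > 0"
    using assms by (simp add: pos_def_hermitian_def)
  then show "Re (hinner x z) > 0"
    using assms(2,3) by (simp add: z hinner_self add_nonneg_pos)
qed

section \<open>The loop\<close>

lemma gain_quotient:
  assumes "hinner v z \<in> \<real>"
  shows "Re ((hinner v v + hinner z z) / (2 * hinner v z)) =
    ((norm v)\<^sup>2 + (norm z)\<^sup>2) / (2 * (v \<bullet> z))"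
proof -
  have "hinner v z = of_real (v \<bullet> z)"
    using assms by (metis Re_hinner of_real_Re)
  then have "(hinner v v + hinner z z) / (2 * hinner v z) =
      of_real (((norm v)\<^sup>2 + (norm z)\<^sup>2) / (2 * (v \<bullet> z)))"
    by (simp add: hinner_self)
  then show ?thesis by (simp only: Re_complex_of_real)
qed

text \<open>
  Expand \<open>0 \<le> (norm (v - z))\<^sup>2\<close>. The bound keeps the argument of \<open>arcosh\<close> in its proper domain.
\<close>

lemma gain_quotient_ge_1:
  assumes "v \<bullet> z > 0"
  shows "((norm v)\<^sup>2 + (norm z)\<^sup>2) / (2 * (v \<bullet> z)) \<ge> 1"
proof -
  have "0 \<le> (norm (v - z))\<^sup>2" by simp
  also have "\<dots> = (norm v)\<^sup>2 + (norm z)\<^sup>2 - 2 * (v \<bullet> z)"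
    by (simp add: power2_norm_eq_inner inner_diff inner_commute)
  finally show ?thesis using assms by simp
qed

lemma gain_set_nonneg:
  fixes A :: "real^'n^'n"
  assumes "y \<in> gain_set A B K \<mu> \<omega>"
  shows "y \<ge> 0"
proof -
  obtain v z :: "complex^'n" where "y = arcosh (Re ((hinner v v + hinner z z) / (2 * hinner v z)))"
    and vz: "hinner v z \<in> \<real>" "Re (hinner v z) > 0"
    using assms unfolding gain_set_def mem_Collect_eq by blast
  then have "y = arcosh (((norm v)\<^sup>2 + (norm z)\<^sup>2) / (2 * (v \<bullet> z)))"
    by (simp only: gain_quotient)
  then show ?thesis
    using vz by (simp only: Re_hinner arcosh_nonneg_real gain_quotient_ge_1)
qed

lemma gain_set_nonempty:
  assumes "\<omega> \<in> crit_freqs A B K \<mu>"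
  shows "gain_set A B K \<mu> \<omega> \<noteq> {}"
proof -
  obtain z w where "w \<in> loop_values A B K \<mu> (\<i> * of_real \<omega>) z"
    "hinner w z \<in> \<real>" "Re (hinner w z) < 0"
    using assms by (auto simp: crit_freqs_def)
  then have "arcosh (Re ((hinner (- w) (- w) + hinner z z) / (2 * hinner (- w) z)))
      \<in> gain_set A B K \<mu> \<omega>"
    unfolding gain_set_def
    by (intro CollectI exI[of _ "- w"] exI[of _ z] conjI refl bexI[of _ w])
      (auto simp: hinner_uminus_left)
  then show ?thesis by blast
qed

text \<open>
  Nonemptiness and nonnegativity of the gain sets rule out the default values of infima of
  empty or unbounded sets of reals.
\<close>

lemma gain_bound_le:
  assumes \<omega>: "\<omega> \<in> crit_freqs A B K \<mu>" and y: "y \<in> gain_set A B K \<mu> \<omega>"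
  shows "gain_bound A B K \<mu> \<le> y"
proof -
  have "bdd_below ((\<lambda>\<omega>. Inf (gain_set A B K \<mu> \<omega>)) ` crit_freqs A B K \<mu>)"
    by (intro bdd_belowI2[of _ 0] cInf_greatest gain_set_nonempty gain_set_nonneg)
  then have "gain_bound A B K \<mu> \<le> Inf (gain_set A B K \<mu> \<omega>)"
    unfolding gain_bound_def using \<omega> by (intro cINF_lower)
  also have "\<dots> \<le> y"
    using y by (intro cInf_lower bdd_belowI[of _ 0] gain_set_nonneg)
  finally show ?thesis .
qed

text \<open>
  Both branches of \<open>loop_values\<close> amount to the defining equation \<open>(s I - A) w = B \<mu> K z\<close>.
\<close>

lemma loop_valuesI:
  assumes "(mat s - cmat A) *v w = (cmat B ** (mat \<mu> ** cmat K)) *v z"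
  shows "w \<in> loop_values A B K \<mu> s z"
proof (cases "invertible (mat s - cmat A)")
  case True
  have "matrix_inv (mat s - cmat A) ** (mat s - cmat A) = mat 1"
    using True unfolding invertible_def matrix_inv_def by (rule someI2_ex) blast
  then have "w = matrix_inv (mat s - cmat A) *v ((mat s - cmat A) *v w)"
    by (simp add: matrix_vector_mul_assoc)
  also have "\<dots> = loop_tf A B K \<mu> s *v z"
    by (simp add: assms loop_tf_def matrix_vector_mul_assoc matrix_mul_assoc)
  finally show ?thesis
    using True by (simp add: loop_values_def)
qed (simp add: loop_values_def assms)

text \<open>
  The affine path \<open>M t\<close> equals \<open>A - H D\<^sub>t\<close>; its crossing of the imaginary axis yields the pair
  \<open>(x, z)\<close> with \<open>z = D\<^sub>t x\<close>.
\<close>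

lemma destabilizing_perturbation:
  assumes nominal: "hurwitz (cmat A - cmat B ** (mat \<mu> ** cmat K))"
    and D: "pos_def_hermitian D"
    and unstable: "\<not> loop_stable A B K \<mu> D"
  shows "crit_freqs A B K \<mu> \<noteq> {} \<and> gain_bound A B K \<mu> \<le> log_spread D"
proof -
  define H where "H = cmat B ** (mat \<mu> ** cmat K)"
  define M where "M t = (1 - t) *\<^sub>R (cmat A - H) + t *\<^sub>R (cmat A - H ** D)" for t :: real
  have "continuous_on {0..1} M"
    unfolding M_def by (intro continuous_intros)
  moreover have "hurwitz (M 0)" "\<not> hurwitz (M 1)"
    using nominal unstable by (auto simp: M_def H_def loop_stable_def)
  ultimately obtain t \<omega> where t: "0 < t" "t \<le> 1" and ev: "eigenvalue (M t) (\<i> * of_real \<omega>)"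
    using hurwitz_path_crossing by metis
  obtain x where x: "x \<noteq> 0" "M t *v x = (\<i> * of_real \<omega>) *s x"
    using ev by (auto simp: eigenvalue_def)
  define z where "z = (1 - t) *\<^sub>R x + t *\<^sub>R (D *v x)"
  have "M t *v x = cmat A *v x - H *v z"
    by (simp add: M_def z_def scaleR_mult_vec matrix_vector_mult_add_rdistrib
        matrix_vector_mult_diff_rdistrib linear_add[OF matrix_vector_mul_linear]
        linear_cmul[OF matrix_vector_mul_linear] linear_diff[OF matrix_vector_mul_linear] algebra_simps
        flip: matrix_vector_mul_assoc)
  then have "(mat (\<i> * of_real \<omega>) - cmat A) *v (- x) = H *v z"
    using x(2)
    by (simp add: matrix_vector_mult_diff_rdistrib mat_vector_mult
        linear_neg[OF matrix_vector_mul_linear] algebra_simps)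
  then have val: "- x \<in> loop_values A B K \<mu> (\<i> * of_real \<omega>) z"
    by (intro loop_valuesI) (simp add: H_def)
  have pos: "hinner x z \<in> \<real>" "Re (hinner x z) > 0"
    using segment_perturbation_pos[OF D t x(1)] by (auto simp: z_def)
  have crit: "\<omega> \<in> crit_freqs A B K \<mu>"
    unfolding crit_freqs_def using val pos
    by (auto simp: hinner_uminus_left intro!: exI[of _ z] bexI[of _ "- x"])
  let ?q = "((norm x)\<^sup>2 + (norm z)\<^sup>2) / (2 * (x \<bullet> z))"
  have "arcosh ?q \<in> gain_set A B K \<mu> \<omega>"
    unfolding gain_set_def
    by (intro CollectI exI[of _ x] exI[of _ z] conjI bexI[of _ "- x"] val pos)
      (simp_all only: gain_quotient[OF pos(1)] minus_minus)
  then have "gain_bound A B K \<mu> \<le> arcosh ?q"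
    by (rule gain_bound_le[OF crit])
  also have "\<dots> \<le> arcosh (cosh (log_spread D))"
  proof -
    have "1 \<le> ?q" using pos by (intro gain_quotient_ge_1) (simp add: Re_hinner)
    moreover have "?q \<le> cosh (log_spread D)"
      using segment_perturbation_bound[OF D t, of x, folded z_def] pos
      by (simp add: Re_hinner pos_divide_le_eq mult_ac)
    ultimately show ?thesis
      using arcosh_less_iff_real[OF cosh_real_ge_1, of ?q "log_spread D"] by (metis not_less)
  qed
  also have "\<dots> = log_spread D"
    by (rule arcosh_cosh_real[OF log_spread_nonneg[OF D]])
  finally show ?thesis
    using crit by blast
qed

theorem mainTheorem11:
  fixes a :: "real^'v^'v"
    and A :: "real^'n^'n" and B :: "real^'m^'n" and K :: "real^'n^'m"
    and c :: real
    and lam :: "nat \<Rightarrow> complex"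
    and \<Delta> :: "nat \<Rightarrow> complex^'n^'n"
    and g :: "nat \<Rightarrow> real"
    and \<Omega> :: "nat \<Rightarrow> real set"
    and P :: "nat set"
  assumes "\<And>i k. a $ i $ k \<ge> 0"
    and "strongly_connected a"
    and "\<exists>r T. directed_spanning_tree a r T"
    and "charpoly (cmat (laplacian a)) = (\<Prod>p = 1..CARD('v). [:- lam p, 1:])"
    and "lam 1 = 0"
    and "stabilizable A B"
    and "hurwitz (cmat (A - B ** K))"
    and "\<And>p. p \<in> {2..CARD('v)} \<Longrightarrow>
           hurwitz (cmat A - cmat B ** (mat (of_real c * lam p) ** cmat K))"
    and "\<And>p. p \<in> {2..CARD('v)} \<Longrightarrow> pos_def_hermitian (\<Delta> p)"
    and "\<And>p. p \<in> {2..CARD('v)} \<Longrightarrow> \<Omega> p = crit_freqs A B K (of_real c * lam p)"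
    and "P = {p \<in> {2..CARD('v)}. \<Omega> p \<noteq> {}}"
    and "(\<forall>p\<in>{2..CARD('v)}. \<Omega> p = {}) \<or>
         (\<forall>p\<in>P. Max {\<bar>ln (Re \<mu>)\<bar> | \<mu>. eigenvalue (\<Delta> p) \<mu>} < g p \<and>
                 g p \<le> gain_bound A B K (of_real c * lam p))"
  shows "\<forall>p\<in>{2..CARD('v)}. loop_stable A B K (of_real c * lam p) (\<Delta> p)"
proof
  fix p assume p: "p \<in> {2..CARD('v)}"
  show "loop_stable A B K (of_real c * lam p) (\<Delta> p)"
  proof (rule ccontr)
    assume "\<not> loop_stable A B K (of_real c * lam p) (\<Delta> p)"
    then have "\<Omega> p \<noteq> {}" "gain_bound A B K (of_real c * lam p) \<le> log_spread (\<Delta> p)"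
      using destabilizing_perturbation[OF assms(8,9)[OF p]] assms(10)[OF p] by simp_all
    moreover from this assms(11,12) p
    have "log_spread (\<Delta> p) < g p" "g p \<le> gain_bound A B K (of_real c * lam p)"
      by (auto simp: log_spread_def)
    ultimately show False by linarith
  qed
qed

end
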